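(* Let $w=(w_m)_{m\in\mathbb{Z}}$ be a sequence of real weights with $w_m>0$ for every $m\in\mathbb{Z}$. The following statements hold. (a) Let $s\in[1,+\infty)$ and let $k,k'\in\mathbb{R}$ with $k<k'$. Then the embedding $h^{k',s}_{\mathbb{C},w}\to h^{k,s}_{\mathbb{C},w}$ is compact. (b) Let $k,k'\in\mathbb{R}$ with $0\le k<k'$, and assume in addition that $\inf_{m\in\mathbb{Z}}w_m>0$. Then, if $s,t$ are real numbers with $s\ge t\ge 1$, there exists the compact embedding $h^{k',t}_{\mathbb{C},w}\to h^{k,s}_{\mathbb{C},w}$. In particular, the embedding $h^{k',t}_{\mathbb{C},w}\to l^{s}_{\mathbb{C},w}$ is compact.
   Context: For $s\in[1,+\infty)$, $k\in\mathbb{R}$ and a sequence of weights $w=(w_m)_{m\in\mathbb{Z}}$ with $w_m>0$ for every $m$, $h^{k,s}_{\mathbb{C},w}$ denotes the Banach space of all complex sequences $p=(p_m)_{m\in\mathbb{Z}}$ with $$\|p\|_{k,s,w}:=\Big(\sum_{m\in\mathbb{Z}}w_m(1+|m|^s)^k|p_m|^s\Big)^{1/s}<+\infty,$$ with the usual componentwise algebraic operations and this norm. Note that the summability exponent $s$ also appears in the factor $(1+|m|^s)^k$. For $k=0$ one writes $l^s_{\mathbb{C},w}:=h^{0,s}_{\mathbb{C},w}$, with norm $\|p\|_{s,w}=\big(\sum_{m\in\mathbb{Z}}w_m|p_m|^s\big)^{1/s}$. An embedding $X\to Y$ between two such spaces means that $X\subseteq Y$ as sets of sequences and that the inclusion map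 $p\mapsto p$ is a continuous linear map from $X$ to $Y$; it is compact if the inclusion map is a compact operator. *)

theory Defs
  imports "HOL-Analysis.Analysis"
begin

section \<open>Normed spaces of bi-infinite complex sequences\<close>

text \<open>
  The spaces below depend on real parameters, so they are represented by a carrier set of sequences
  together with a norm on that carrier; the algebraic operations are the componentwise ones.  The
  general notions in this section are meant for pairs that are complex normed spaces.
\<close>

type_synonym cseq = "int \<Rightarrow> complex"
type_synonym seq_space = "cseq set \<times> (cseq \<Rightarrow> real)"

definition carr :: "seq_space \<Rightarrow> cseq set" where
  "carr X = fst X"

definition nrm :: "seq_space \<Rightarrow> cseq \<Rightarrow> real" where
  "nrm X = snd X"

definition dst :: "seq_space \<Rightarrow> cseq \<Rightarrow> cseq \<Rightarrow> real" where
  "dst X p q = nrm X (\<lambda>m. p m - q m)"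

definition norm_topology :: "seq_space \<Rightarrow> cseq topology" where
  "norm_topology X = Metric_space.mtopology (carr X) (dst X)"

definition bounded_in :: "seq_space \<Rightarrow> cseq set \<Rightarrow> bool" where
  "bounded_in X B \<longleftrightarrow> Metric_space.mbounded (carr X) (dst X) B"

definition continuous_linear :: "seq_space \<Rightarrow> seq_space \<Rightarrow> (cseq \<Rightarrow> cseq) \<Rightarrow> bool" where
  "continuous_linear X Y T \<longleftrightarrow>
     T \<in> carr X \<rightarrow> carr Y \<and>
     (\<forall>p\<in>carr X. \<forall>q\<in>carr X. T (\<lambda>m. p m + q m) = (\<lambda>m. T p m + T q m)) \<and>
     (\<forall>c. \<forall>p\<in>carr X. T (\<lambda>m. c * p m) = (\<lambda>m. c * T p m)) \<and>
     continuous_map (norm_topology X) (norm_topology Y) T"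

text \<open>A compact operator maps bounded sets to relatively compact sets.\<close>

definition compact_operator :: "seq_space \<Rightarrow> seq_space \<Rightarrow> (cseq \<Rightarrow> cseq) \<Rightarrow> bool" where
  "compact_operator X Y T \<longleftrightarrow>
     continuous_linear X Y T \<and>
     (\<forall>B. bounded_in X B \<longrightarrow>
        compactin (norm_topology Y) (norm_topology Y closure_of (T ` B)))"

definition embedding :: "seq_space \<Rightarrow> seq_space \<Rightarrow> bool" where
  "embedding X Y \<longleftrightarrow> carr X \<subseteq> carr Y \<and> continuous_linear X Y (\<lambda>p. p)"

definition compact_embedding :: "seq_space \<Rightarrow> seq_space \<Rightarrow> bool" where
  "compact_embedding X Y \<longleftrightarrow> embedding X Y \<and> compact_operator X Y (\<lambda>p. p)"


section \<open>The weighted spaces\<close>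

text \<open>
  The exponents are real, hence \<open>powr\<close>; note that \<open>0 powr s = 0\<close> gives the intended value at
  \<open>m = 0\<close> and at \<open>p m = 0\<close>.  All terms are nonnegative, so summability over \<open>UNIV\<close> says exactly
  that the sum is finite.
\<close>

definition h_term :: "(int \<Rightarrow> real) \<Rightarrow> real \<Rightarrow> real \<Rightarrow> cseq \<Rightarrow> int \<Rightarrow> real" where
  "h_term w k s p m = w m * (1 + \<bar>real_of_int m\<bar> powr s) powr k * cmod (p m) powr s"

definition h_space :: "(int \<Rightarrow> real) \<Rightarrow> real \<Rightarrow> real \<Rightarrow> seq_space" where
  "h_space w k s =
     ({p. h_term w k s p summable_on UNIV},
      \<lambda>p. (\<Sum>\<^sub>\<infinity>m. h_term w k s p m) powr (1 / s))"

definition l_space :: "(int \<Rightarrow> real) \<Rightarrow> real \<Rightarrow> seq_space" where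
  "l_space w s = h_space w 0 s"


section \<open>The weighted spaces are normed spaces\<close>

lemma carr_h: "p \<in> carr (h_space w k s) \<longleftrightarrow> h_term w k s p summable_on UNIV"
  by (simp add: carr_def h_space_def)

lemma nrm_h: "nrm (h_space w k s) p = (\<Sum>\<^sub>\<infinity>m. h_term w k s p m) powr (1 / s)"
  by (simp add: nrm_def h_space_def)

lemma carr_l: "p \<in> carr (l_space w s) \<longleftrightarrow> (\<lambda>m. w m * cmod (p m) powr s) summable_on UNIV"
proof -
  have "1 + \<bar>real_of_int m\<bar> powr s \<noteq> 0" for m
    by (smt (verit) powr_ge_zero)
  then have "h_term w 0 s p = (\<lambda>m. w m * cmod (p m) powr s)"
    by (auto simp: h_term_def)
  then show ?thesis
    by (simp add: l_space_def carr_h)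
qed

lemma nrm_l: "nrm (l_space w s) p = (\<Sum>\<^sub>\<infinity>m. w m * cmod (p m) powr s) powr (1 / s)"
proof -
  have "1 + \<bar>real_of_int m\<bar> powr s \<noteq> 0" for m
    by (smt (verit) powr_ge_zero)
  then have "h_term w 0 s p = (\<lambda>m. w m * cmod (p m) powr s)"
    by (auto simp: h_term_def)
  then show ?thesis
    by (simp add: l_space_def nrm_h)
qed

lemma powr_convex_nonneg:
  fixes x y a s :: real
  assumes "s \<ge> 1" "x \<ge> 0" "y \<ge> 0" "0 < a" "a < 1"
  shows "(a * x + (1 - a) * y) powr s \<le> a * x powr s + (1 - a) * y powr s"
proof -
  have small: "b powr s \<le> b" if "0 < b" "b < 1" for b :: real
    using powr_mono'[of 1 s b] that assms(1) by simp
  consider "x = 0" | "y = 0" | "x > 0" "y > 0"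
    using assms by linarith
  then show ?thesis
  proof cases
    case 1
    have "((1 - a) * y) powr s = (1 - a) powr s * y powr s"
      using assms by (simp add: powr_mult)
    then show ?thesis
      using 1 small[of "1 - a"] assms by (simp add: mult_right_mono)
  next
    case 2
    have "(a * x) powr s = a powr s * x powr s"
      using assms by (simp add: powr_mult)
    then show ?thesis
      using 2 small[of a] assms by (simp add: mult_right_mono)
  next
    case 3
    then show ?thesis
      using convex_onD[OF powr_convex[OF assms(1)], of "1 - a" x y] assms by simp
  qed
qed

context
  fixes w :: "int \<Rightarrow> real" and k s :: real
  assumes w_pos: "\<And>m. w m > 0" and s_ge_1: "s \<ge> 1"
begin

lemma h_coeff_pos: "w m * (1 + \<bar>real_of_int m\<bar> powr s) powr k > 0"
  using w_pos[of m] by (smt (verit) mult_pos_pos powr_ge_zero powr_gt_zero)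

lemma h_term_nonneg: "h_term w k s p m \<ge> 0"
  unfolding h_term_def using h_coeff_pos[of m] by simp

lemma h_term_mono:
  assumes "cmod (p m) \<le> cmod (q m)"
  shows "h_term w k s p m \<le> h_term w k s q m"
  unfolding h_term_def
  using assms h_coeff_pos[of m] s_ge_1 by (intro mult_left_mono powr_mono2) auto

lemma h_term_scale: "h_term w k s (\<lambda>m. c * p m) m = cmod c powr s * h_term w k s p m"
  by (simp add: h_term_def norm_mult powr_mult)

lemma h_term_add_scaled:
  assumes "0 < a" "a < 1"
  shows "h_term w k s (\<lambda>m. p m + q m) m \<le>
           a * (inverse a powr s * h_term w k s p m)
           + (1 - a) * (inverse (1 - a) powr s * h_term w k s q m)"
proof -
  let ?x = "inverse a * cmod (p m)" and ?y = "inverse (1 - a) * cmod (q m)"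
  have "cmod (p m + q m) powr s \<le> (a * ?x + (1 - a) * ?y) powr s"
    using assms s_ge_1 norm_triangle_ineq[of "p m" "q m"]
    by (intro powr_mono2) (auto simp: mult.assoc[symmetric])
  also have "\<dots> \<le> a * ?x powr s + (1 - a) * ?y powr s"
    using assms s_ge_1 by (intro powr_convex_nonneg) auto
  also have "\<dots> = a * (inverse a powr s * cmod (p m) powr s)
                + (1 - a) * (inverse (1 - a) powr s * cmod (q m) powr s)"
    using assms by (simp add: powr_mult)
  finally have "(w m * (1 + \<bar>real_of_int m\<bar> powr s) powr k) * cmod (p m + q m) powr s \<le>
      (w m * (1 + \<bar>real_of_int m\<bar> powr s) powr k) *
      (a * (inverse a powr s * cmod (p m) powr s)
        + (1 - a) * (inverse (1 - a) powr s * cmod (q m) powr s))"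
    using h_coeff_pos[of m] by (intro mult_left_mono) auto
  then show ?thesis
    by (simp add: h_term_def algebra_simps)
qed

lemma h_zero: "(\<lambda>m. 0) \<in> carr (h_space w k s)"
  by (simp add: carr_h h_term_def[abs_def])

lemma h_scale:
  assumes "p \<in> carr (h_space w k s)"
  shows "(\<lambda>m. c * p m) \<in> carr (h_space w k s)"
proof -
  have "h_term w k s (\<lambda>m. c * p m) = (\<lambda>m. cmod c powr s * h_term w k s p m)"
    by (simp add: h_term_scale fun_eq_iff)
  then show ?thesis
    using assms by (simp add: carr_h summable_on_cmult_right)
qed

lemma h_add:
  assumes "p \<in> carr (h_space w k s)" "q \<in> carr (h_space w k s)"
  shows "(\<lambda>m. p m + q m) \<in> carr (h_space w k s)"
  unfolding carr_h
proof (rule summable_on_comparison_test)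
  show "(\<lambda>m. (1/2) * (inverse (1/2) powr s * h_term w k s p m)
          + (1 - 1/2) * (inverse (1 - 1/2) powr s * h_term w k s q m)) summable_on UNIV"
    using assms unfolding carr_h
    by (intro summable_on_add summable_on_cmult_right)
  show "h_term w k s (\<lambda>m. p m + q m) m \<le>
     (1/2) * (inverse (1/2) powr s * h_term w k s p m)
          + (1 - 1/2) * (inverse (1 - 1/2) powr s * h_term w k s q m)" for m
    by (rule h_term_add_scaled) auto
qed (rule h_term_nonneg)

lemma h_diff:
  assumes "p \<in> carr (h_space w k s)" "q \<in> carr (h_space w k s)"
  shows "(\<lambda>m. p m - q m) \<in> carr (h_space w k s)"
  using h_add[OF assms(1) h_scale[OF assms(2), of "-1"]] by simp

lemma h_nrm_nonneg: "nrm (h_space w k s) p \<ge> 0"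
  by (simp add: nrm_h)

lemma h_nrm_powr: "nrm (h_space w k s) p powr s = (\<Sum>\<^sub>\<infinity>m. h_term w k s p m)"
  using s_ge_1 by (simp add: nrm_h powr_powr infsum_nonneg h_term_nonneg)

lemma h_nrm_eq_0:
  assumes "p \<in> carr (h_space w k s)"
  shows "nrm (h_space w k s) p = 0 \<longleftrightarrow> p = (\<lambda>m. 0)"
proof
  assume "nrm (h_space w k s) p = 0"
  then have "(\<Sum>\<^sub>\<infinity>m. h_term w k s p m) = 0"
    by (simp add: nrm_h)
  then have "h_term w k s p m = 0" for m
    using assms by (intro nonneg_infsum_le_0D[of "h_term w k s p" UNIV])
      (auto simp: carr_h h_term_nonneg)
  then show "p = (\<lambda>m. 0)"
    using h_coeff_pos unfolding h_term_def fun_eq_iff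
    by (metis less_irrefl mult_eq_0_iff norm_eq_zero powr_eq_0_iff)
qed (simp add: nrm_h h_term_def)

lemma h_nrm_scale:
  "nrm (h_space w k s) (\<lambda>m. c * p m) = cmod c * nrm (h_space w k s) p"
proof -
  have "nrm (h_space w k s) (\<lambda>m. c * p m) =
          (cmod c powr s * (\<Sum>\<^sub>\<infinity>m. h_term w k s p m)) powr (1 / s)"
    by (simp add: nrm_h h_term_scale infsum_cmult_right')
  also have "\<dots> = cmod c * nrm (h_space w k s) p"
    using s_ge_1
    by (simp add: nrm_h powr_mult powr_powr infsum_nonneg h_term_nonneg)
  finally show ?thesis .
qed

lemma h_nrm_triangle:
  assumes p: "p \<in> carr (h_space w k s)" and q: "q \<in> carr (h_space w k s)"
  shows "nrm (h_space w k s) (\<lambda>m. p m + q m) \<le> nrm (h_space w k s) p + nrm (h_space w k s) q"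
proof -
  let ?N = "nrm (h_space w k s)"
  consider "?N p = 0" | "?N q = 0" | "?N p > 0" "?N q > 0"
    using h_nrm_nonneg[of p] h_nrm_nonneg[of q] by linarith
  then show ?thesis
  proof cases
    case 1
    then show ?thesis using h_nrm_eq_0[OF p] by simp
  next
    case 2
    then show ?thesis using h_nrm_eq_0[OF q] by simp
  next
    case 3
    define a where "a = ?N p / (?N p + ?N q)"
    have a: "0 < a" "a < 1"
      using 3 by (auto simp: a_def)
    have a': "1 - a = ?N q / (?N p + ?N q)"
      using 3 by (simp add: a_def field_simps)
    have "?N (\<lambda>m. p m + q m) powr s = (\<Sum>\<^sub>\<infinity>m. h_term w k s (\<lambda>m. p m + q m) m)"
      by (rule h_nrm_powr)
    also have "\<dots> \<le> (\<Sum>\<^sub>\<infinity>m. a * (inverse a powr s * h_term w k s p m)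
           + (1 - a) * (inverse (1 - a) powr s * h_term w k s q m))"
      using p q h_add[OF p q] h_term_add_scaled[OF a] unfolding carr_h
      by (intro infsum_mono summable_on_add summable_on_cmult_right) auto
    also have "\<dots> = a * (inverse a powr s * ?N p powr s)
           + (1 - a) * (inverse (1 - a) powr s * ?N q powr s)"
      using p q unfolding carr_h
      by (subst infsum_add) (auto intro!: summable_on_cmult_right
          simp: infsum_cmult_right' h_nrm_powr)
    also have "inverse a powr s * ?N p powr s = (?N p + ?N q) powr s"
      using 3 a by (simp add: powr_mult[symmetric] a_def)
    also have "inverse (1 - a) powr s * ?N q powr s = (?N p + ?N q) powr s"
      using 3 a unfolding a' by (simp add: powr_mult[symmetric])
    finally have "?N (\<lambda>m. p m + q m) powr s \<le> (?N p + ?N q) powr s"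
      by (simp add: algebra_simps)
    then show ?thesis
      using s_ge_1 3 h_nrm_nonneg
      by (smt (verit) powr_less_mono2)
  qed
qed

lemma h_Metric_space: "Metric_space (carr (h_space w k s)) (dst (h_space w k s))"
proof
  fix p q r
  show "0 \<le> dst (h_space w k s) p q"
    by (simp add: dst_def h_nrm_nonneg)
  show "dst (h_space w k s) p q = dst (h_space w k s) q p"
    by (simp add: dst_def nrm_h h_term_def norm_minus_commute)
  assume p: "p \<in> carr (h_space w k s)" and q: "q \<in> carr (h_space w k s)"
  show "dst (h_space w k s) p q = 0 \<longleftrightarrow> p = q"
    using h_nrm_eq_0[OF h_diff[OF p q]] by (auto simp: dst_def fun_eq_iff)
  assume r: "r \<in> carr (h_space w k s)"
  show "dst (h_space w k s) p r \<le> dst (h_space w k s) p q + dst (h_space w k s) q r"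
    using h_nrm_triangle[OF h_diff[OF p q] h_diff[OF q r]] by (simp add: dst_def)
qed

end

end

theory Submission
  imports Defs "HOL-Real_Asymp.Real_Asymp"
begin

text \<open>
  The norm balls of a weighted space are compact for the topology of componentwise convergence: they
  are closed subsets of products of discs.  On such a ball, componentwise convergence implies
  convergence in the target norm, because each term of the target sum is a factor tending to zero
  times a power of the corresponding term of the source sum, which makes the tails uniformly small.
  Hence bounded sets of the source lie in compact subsets of the target.
\<close>

section \<open>Decay and comparison of the weight factors\<close>

text \<open>A bounded interval contains only finitely many integers, so the absolute value tends to
  infinity along \<open>cofinite\<close> and real limits at infinity transfer to two-sided index
  sequences.\<close>

lemma tendsto_cofinite_abs_int:
  fixes f :: "real \<Rightarrow> real"
  assumes "(f \<longlongrightarrow> l) at_top"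
  shows "((\<lambda>m. f \<bar>real_of_int m\<bar>) \<longlongrightarrow> l) cofinite"
proof -
  have "filterlim (\<lambda>m. \<bar>real_of_int m\<bar>) at_top cofinite"
    unfolding filterlim_at_top eventually_cofinite
  proof
    fix Z :: real
    have "{m. \<not> Z \<le> \<bar>real_of_int m\<bar>} \<subseteq> {- \<lceil>Z\<rceil>..\<lceil>Z\<rceil>}"
      by (auto simp: not_le) linarith+
    then show "finite {m. \<not> Z \<le> \<bar>real_of_int m\<bar>}"
      by (rule finite_subset) simp
  qed
  then show ?thesis
    using assms by (rule filterlim_compose[rotated])
qed

lemma powr_one_add_abs_tendsto_0:
  assumes "t > 0" "a < 0"
  shows "((\<lambda>m. (1 + \<bar>real_of_int m\<bar> powr t) powr a) \<longlongrightarrow> 0) cofinite"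
proof (rule tendsto_cofinite_abs_int)
  have "filterlim (\<lambda>x::real. 1 + x powr t) at_top at_top"
    using assms(1) by real_asymp
  then show "((\<lambda>x::real. (1 + x powr t) powr a) \<longlongrightarrow> 0) at_top"
    using assms(2) tendsto_neg_powr by blast
qed

text \<open>Superadditivity of the power \<open>s / t \<ge> 1\<close>, applied to 1 and
  \<open>x powr t\<close> and then raised to the nonnegative power \<open>k\<close>. It trades the
  weight factor built with \<open>s\<close> for the one built with \<open>t\<close>.\<close>

lemma one_add_powr_le:
  fixes x s t k :: real
  assumes "x \<ge> 0" "t > 0" "s \<ge> t" "k \<ge> 0"
  shows "(1 + x powr s) powr k \<le> (1 + x powr t) powr (k * s / t)"
proof -
  define y where "y = x powr t"
  have y: "y \<ge> 0" "x powr s = y powr (s / t)"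
    using assms by (auto simp: y_def powr_powr)
  have r: "s / t \<ge> 1"
    using assms by simp
  \<comment> \<open>After division by the right-hand side, the bases \<open>1 / (1 + y)\<close> and
    \<open>y / (1 + y)\<close> lie in the unit interval and sum to 1; an exponent at least 1 does
    not increase them.\<close>
  have "1 + y powr (s / t) \<le> (1 + y) powr (s / t)"
  proof -
    have le: "(z / (1 + y)) powr (s / t) \<le> z / (1 + y)" if "0 \<le> z" "z \<le> 1 + y" for z
      using that r y powr_mono'[of 1 "s / t" "z / (1 + y)"] by simp
    have "(1 / (1 + y)) powr (s / t) + (y / (1 + y)) powr (s / t) \<le> 1 / (1 + y) + y / (1 + y)"
      using y by (intro add_mono le) auto
    also have "\<dots> = 1"
      using y by (simp add: add_divide_distrib[symmetric])
    finally show ?thesis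
      using y by (simp add: powr_divide add_divide_distrib[symmetric])
  qed
  then have "(1 + y powr (s / t)) powr k \<le> ((1 + y) powr (s / t)) powr k"
    using assms by (intro powr_mono2) auto
  then show ?thesis
    unfolding y(2) by (simp add: powr_powr y_def mult.commute)
qed

section \<open>Norm balls and componentwise convergence\<close>

text \<open>A plain set of sequences, so that it can be studied both in the product topology of the
  function type \<open>cseq\<close> and in the norm topologies.\<close>

definition h_ball :: "(int \<Rightarrow> real) \<Rightarrow> real \<Rightarrow> real \<Rightarrow> real \<Rightarrow> cseq set" where
  "h_ball w k s R = {q \<in> carr (h_space w k s). nrm (h_space w k s) q \<le> R}"

context
  fixes w :: "int \<Rightarrow> real" and k s :: real
  assumes w_pos: "\<And>m. w m > 0" and s_ge_1: "s \<ge> 1"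
begin

lemma dst_le_imp_h_ball:
  assumes "p \<in> carr (h_space w k s)" "q \<in> carr (h_space w k s)" "dst (h_space w k s) p q \<le> R"
  shows "q \<in> h_ball w k s (nrm (h_space w k s) p + R)"
proof -
  interpret Metric_space "carr (h_space w k s)" "dst (h_space w k s)"
    using w_pos s_ge_1 by (rule h_Metric_space)
  have "dst (h_space w k s) q (\<lambda>m. 0) \<le> dst (h_space w k s) q p + dst (h_space w k s) p (\<lambda>m. 0)"
    using assms h_zero[where w = w, OF w_pos s_ge_1] by (intro triangle) auto
  then show ?thesis
    using assms by (simp add: h_ball_def dst_def commute[of q p, unfolded dst_def])
qed

lemma bounded_in_imp_subset_h_ball:
  assumes "bounded_in (h_space w k s) B"
  obtains R where "R \<ge> 0" "B \<subseteq> h_ball w k s R"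
proof -
  interpret Metric_space "carr (h_space w k s)" "dst (h_space w k s)"
    using w_pos s_ge_1 by (rule h_Metric_space)
  obtain x r where xr: "B \<subseteq> mcball x r"
    using assms by (auto simp: bounded_in_def mbounded_def)
  \<comment> \<open>The absolute value keeps the radius nonnegative even when \<open>r\<close> is
    negative and the metric ball is empty.\<close>
  have "B \<subseteq> h_ball w k s \<bar>nrm (h_space w k s) x + r\<bar>"
  proof
    fix q assume "q \<in> B"
    then have "q \<in> h_ball w k s (nrm (h_space w k s) x + r)"
      using xr by (intro dst_le_imp_h_ball) auto
    then show "q \<in> h_ball w k s \<bar>nrm (h_space w k s) x + r\<bar>"
      by (auto simp: h_ball_def)
  qed
  then show thesis
    by (intro that[of "\<bar>nrm (h_space w k s) x + r\<bar>"]) auto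
qed

lemma h_ball_diff_nrm_le:
  assumes "p \<in> h_ball w k s R" "q \<in> h_ball w k s R"
  shows "nrm (h_space w k s) (\<lambda>m. p m - q m) \<le> 2 * R"
proof -
  have "nrm (h_space w k s) (\<lambda>m. p m + (-1) * q m)
      \<le> nrm (h_space w k s) p + nrm (h_space w k s) (\<lambda>m. (-1) * q m)"
    using assms h_scale[where w = w, OF w_pos s_ge_1, of q k "-1"]
    by (intro h_nrm_triangle[where w = w, OF w_pos s_ge_1]) (auto simp: h_ball_def)
  then show ?thesis
    using assms h_nrm_scale[where w = w, OF w_pos s_ge_1, of k "-1" q] by (simp add: h_ball_def)
qed

text \<open>Since the terms are nonnegative, bounding the full sum amounts to bounding every finite
  partial sum. Each of these conditions involves finitely many coordinates, hence is closed under
  componentwise convergence.\<close>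

lemma h_ball_eq:
  assumes "R \<ge> 0"
  shows "h_ball w k s R = (\<Inter>F\<in>Collect finite. {q. sum (h_term w k s q) F \<le> R powr s})"
proof (intro equalityI subsetI)
  fix q assume "q \<in> h_ball w k s R"
  then have q: "h_term w k s q summable_on UNIV" "nrm (h_space w k s) q \<le> R"
    by (auto simp: h_ball_def carr_h)
  have "infsum (h_term w k s q) UNIV \<le> R powr s"
    using q(2) s_ge_1 h_nrm_nonneg[where w = w, OF w_pos s_ge_1, of k q]
    by (subst h_nrm_powr[where w = w, OF w_pos s_ge_1, symmetric]) (intro powr_mono2, auto)
  moreover have "sum (h_term w k s q) F \<le> infsum (h_term w k s q) UNIV" if "finite F" for F
    using that q(1) h_term_nonneg[where w = w, OF w_pos s_ge_1] by (intro finite_sum_le_infsum) auto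
  ultimately show "q \<in> (\<Inter>F\<in>Collect finite. {q. sum (h_term w k s q) F \<le> R powr s})"
    by (auto intro: order_trans)
next
  fix q assume "q \<in> (\<Inter>F\<in>Collect finite. {q. sum (h_term w k s q) F \<le> R powr s})"
  then have le: "sum (h_term w k s q) F \<le> R powr s" if "finite F" for F
    using that by auto
  have summ: "h_term w k s q summable_on UNIV"
    using le h_term_nonneg[where w = w, OF w_pos s_ge_1]
    by (intro nonneg_bdd_above_summable_on bdd_aboveI2[where M = "R powr s"]) auto
  then have "infsum (h_term w k s q) UNIV \<le> R powr s"
    using le by (intro infsum_le_finite_sums) auto
  then have "nrm (h_space w k s) q powr s \<le> R powr s"
    by (simp add: h_nrm_powr[where w = w, OF w_pos s_ge_1])
  then have "nrm (h_space w k s) q \<le> R"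
    using assms s_ge_1 powr_less_mono2[of s R "nrm (h_space w k s) q"] by force
  then show "q \<in> h_ball w k s R"
    using summ by (simp add: h_ball_def carr_h)
qed

text \<open>Only one coordinate of \<open>q\<close> enters, so this is continuity in the product
  topology. The shift by \<open>p\<close> serves continuity of the inclusion at \<open>p\<close>;
  the zero shift serves closedness of the balls.\<close>

lemma continuous_on_h_term: "continuous_on A (\<lambda>q. h_term w k s (\<lambda>m. q m - p m) m)"
proof -
  have "continuous_on A (\<lambda>q::cseq. q m)"
    by (rule continuous_on_subset[OF continuous_on_product_coordinates]) simp
  then show ?thesis
    unfolding h_term_def using s_ge_1
    by (intro continuous_on_mult continuous_on_const continuous_on_powr' continuous_on_norm
        continuous_on_diff) auto
qed

lemma closed_h_ball:
  assumes "R \<ge> 0"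
  shows "closed (h_ball w k s R)"
  unfolding h_ball_eq[OF assms]
  using continuous_on_h_term[where p = "\<lambda>m. 0"]
  by (intro closed_INT ballI closed_Collect_le continuous_intros) simp_all

text \<open>Tychonoff: the bound on a single term confines each coordinate to a disc, and the ball
  is a closed subset of the product of these discs.\<close>

lemma compact_h_ball:
  assumes "R \<ge> 0"
  shows "compact (h_ball w k s R)"
proof -
  \<comment> \<open>The disc radius comes from solving
    \<open>h_term w k s q m \<le> R powr s\<close> for \<open>cmod (q m)\<close>.\<close>
  define b where "b m = (R powr s / (w m * (1 + \<bar>real_of_int m\<bar> powr s) powr k)) powr (1 / s)" for m
  have "h_ball w k s R \<subseteq> (\<Pi>\<^sub>E m\<in>UNIV. cball 0 (b m))"
  proof
    fix q assume "q \<in> h_ball w k s R"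
    then have "sum (h_term w k s q) F \<le> R powr s" if "finite F" for F
      using that by (auto simp: h_ball_eq[OF assms])
    from this[of "{m}" for m] have le: "h_term w k s q m \<le> R powr s" for m
      by simp
    have "cmod (q m) \<le> b m" for m
    proof -
      have "cmod (q m) powr s \<le> R powr s / (w m * (1 + \<bar>real_of_int m\<bar> powr s) powr k)"
        using le[of m] h_coeff_pos[where w = w, OF w_pos s_ge_1, of m k]
        by (simp add: h_term_def pos_le_divide_eq mult.commute)
      then have "(cmod (q m) powr s) powr (1 / s) \<le> b m"
        unfolding b_def using s_ge_1 by (intro powr_mono2) auto
      then show ?thesis
        using s_ge_1 by (simp add: powr_powr)
    qed
    then show "q \<in> (\<Pi>\<^sub>E m\<in>UNIV. cball 0 (b m))"
      by auto
  qed
  moreover have "compactin (product_topology (\<lambda>m::int. euclidean :: complex topology) UNIV)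
                   (\<Pi>\<^sub>E m\<in>UNIV. cball 0 (b m))"
    by (subst compactin_PiE) auto
  then have "compact (\<Pi>\<^sub>E m\<in>UNIV. cball (0::complex) (b m))"
    by (simp add: euclidean_product_topology)
  ultimately show ?thesis
    using closed_h_ball[OF assms] compact_Int_closed by (metis inf.absorb_iff2)
qed

end

section \<open>Compactness of the inclusions\<close>

context
  fixes w :: "int \<Rightarrow> real" and k k' s t :: real and e :: "int \<Rightarrow> real"
  assumes w_pos: "\<And>m. w m > 0" and t_ge_1: "1 \<le> t" and s_ge_t: "t \<le> s"
    and e_nonneg: "\<And>m. 0 \<le> e m" and e_tendsto: "(e \<longlongrightarrow> 0) cofinite"
    and h_term_le: "\<And>q m. h_term w k s q m \<le> e m * h_term w k' t q m powr (s / t)"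
begin

private lemma s_ge_1: "1 \<le> s"
  using t_ge_1 s_ge_t by simp

private abbreviation (input) "X \<equiv> h_space w k' t"
private abbreviation (input) "Y \<equiv> h_space w k s"

private lemma finite_ge: "\<epsilon> > 0 \<Longrightarrow> finite {m. \<epsilon> \<le> e m}"
  using order_tendstoD(2)[OF e_tendsto, of \<epsilon>] by (simp add: eventually_cofinite not_less)

text \<open>Let \<open>A\<close> be the source sum. Every source term is at most \<open>A\<close>,
  so the sum of their powers \<open>s / t \<ge> 1\<close> is at most \<open>A powr (s / t)\<close>,
  which is \<open>nrm X q powr s\<close>. Off \<open>F\<close> the factor \<open>e\<close>
  contributes at most \<epsilon>. An empty \<open>F\<close> yields boundedness of the inclusion, a
  large one yields small tails.\<close>

lemma inclusion_tail_estimate: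
  assumes q: "q \<in> carr X" and F: "finite F" and \<epsilon>: "\<And>m. m \<notin> F \<Longrightarrow> e m \<le> \<epsilon>" "\<epsilon> \<ge> 0"
  shows "q \<in> carr Y"
    and "nrm Y q powr s \<le> sum (h_term w k s q) F + \<epsilon> * nrm X q powr s"
proof -
  define A where "A = infsum (h_term w k' t q) UNIV"
  have summ: "h_term w k' t q summable_on UNIV"
    using q by (simp add: carr_h)
  have A: "h_term w k' t q m \<le> A" for m
    using finite_sum_le_infsum[OF summ, of "{m}"] h_term_nonneg[where w = w, OF w_pos t_ge_1]
    by (simp add: A_def)
  have A_nonneg: "A \<ge> 0"
    unfolding A_def by (intro infsum_nonneg h_term_nonneg[where w = w, OF w_pos t_ge_1])
  have split: "x powr (s / t) = x powr (s / t - 1) * x" if "x \<ge> 0" for x :: real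
    using that powr_add[of x "s / t - 1" 1] by (cases "x = 0") auto
  \<comment> \<open>A summable majorant: the target terms themselves on \<open>F\<close>, plus the
    tail bound at every index, which on \<open>F\<close> only adds something nonnegative.\<close>
  define g where "g m = (if m \<in> F then h_term w k s q m else 0)
                        + \<epsilon> * A powr (s / t - 1) * h_term w k' t q m" for m
  have le: "h_term w k s q m \<le> g m" for m
  proof (cases "m \<in> F")
    case True
    then show ?thesis
      using \<epsilon>(2) h_term_nonneg[where w = w, OF w_pos t_ge_1, of k' q m] by (simp add: g_def)
  next
    case False
    have "h_term w k' t q m powr (s / t) \<le> A powr (s / t - 1) * h_term w k' t q m"
      unfolding split[OF h_term_nonneg[where w = w, OF w_pos t_ge_1]]
      using A h_term_nonneg[where w = w, OF w_pos t_ge_1] t_ge_1 s_ge_t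
      by (intro mult_right_mono powr_mono2) auto
    then have "e m * h_term w k' t q m powr (s / t) \<le> \<epsilon> * (A powr (s / t - 1) * h_term w k' t q m)"
      using \<epsilon> False by (intro mult_mono) auto
    then show ?thesis
      using False h_term_le[of q m] by (simp add: g_def mult.assoc)
  qed
  have sF: "(\<lambda>m. if m \<in> F then h_term w k s q m else 0) summable_on UNIV"
    using F by (subst summable_on_cong_neutral[where T = F and g = "h_term w k s q"]) auto
  have iF: "infsum (\<lambda>m. if m \<in> F then h_term w k s q m else 0) UNIV = sum (h_term w k s q) F"
    using F by (subst infsum_cong_neutral[where T = F and g = "h_term w k s q"]) auto
  have sX: "(\<lambda>m. \<epsilon> * A powr (s / t - 1) * h_term w k' t q m) summable_on UNIV"
    using summ by (intro summable_on_cmult_right)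
  have g: "g summable_on UNIV"
    unfolding g_def using sF sX by (rule summable_on_add)
  show qY: "q \<in> carr Y"
    unfolding carr_h using g le h_term_nonneg[where w = w, OF w_pos s_ge_1]
    by (rule summable_on_comparison_test)
  have "nrm Y q powr s = infsum (h_term w k s q) UNIV"
    by (rule h_nrm_powr[where w = w, OF w_pos s_ge_1])
  also have "\<dots> \<le> infsum g UNIV"
    using qY g le by (intro infsum_mono) (auto simp: carr_h)
  also have "\<dots> = sum (h_term w k s q) F + \<epsilon> * (A powr (s / t - 1) * A)"
    unfolding g_def by (subst infsum_add[OF sF sX]) (simp add: iF infsum_cmult_right' A_def)
  also have "A powr (s / t - 1) * A = nrm X q powr s"
    using split[OF A_nonneg] t_ge_1
    by (simp add: A_def h_nrm_powr[where w = w, OF w_pos t_ge_1, symmetric] powr_powr)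
  finally show "nrm Y q powr s \<le> sum (h_term w k s q) F + \<epsilon> * nrm X q powr s" .
qed

lemma inclusion_bounded:
  obtains C where "C > 0" "\<And>q. q \<in> carr X \<Longrightarrow> q \<in> carr Y \<and> nrm Y q \<le> C * nrm X q"
proof -
  \<comment> \<open>A crude upper bound for all \<open>e m\<close>: the summand 1 covers the values
    below 1, and the finite sum dominates each of the others.\<close>
  define D where "D = 1 + sum e {m. 1 \<le> e m}"
  have fin: "finite {m. 1 \<le> e m}"
    by (rule finite_ge) simp
  have D: "D > 0"
    unfolding D_def using e_nonneg by (smt (verit) sum_nonneg)
  have le: "e m \<le> D" for m
  proof (cases "1 \<le> e m")
    case True
    then have "e m \<le> sum e {m. 1 \<le> e m}"
      using fin e_nonneg by (intro member_le_sum) auto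
    then show ?thesis by (simp add: D_def)
  next
    case False
    then show ?thesis
      unfolding D_def using e_nonneg by (smt (verit) sum_nonneg)
  qed
  show thesis
  proof (rule that[of "D powr (1 / s)"])
    fix q assume q: "q \<in> carr X"
    have "nrm Y q powr s \<le> D * nrm X q powr s"
      using inclusion_tail_estimate(2)[OF q, of "{}" D] le D by simp
    then have "(nrm Y q powr s) powr (1 / s) \<le> (D * nrm X q powr s) powr (1 / s)"
      using s_ge_1 by (intro powr_mono2) auto
    then show "q \<in> carr Y \<and> nrm Y q \<le> D powr (1 / s) * nrm X q"
      using inclusion_tail_estimate(1)[OF q, of "{}" D] le D s_ge_1
        h_nrm_nonneg[where w = w, OF w_pos s_ge_1, of k q] h_nrm_nonneg[where w = w, OF w_pos t_ge_1, of k' q]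
      by (simp add: powr_mult powr_powr)
  qed (use D in simp)
qed

lemma embedding_inclusion: "embedding X Y"
proof -
  interpret MX: Metric_space "carr X" "dst X"
    using w_pos t_ge_1 by (rule h_Metric_space)
  interpret MY: Metric_space "carr Y" "dst Y"
    using w_pos s_ge_1 by (rule h_Metric_space)
  obtain C where C: "C > 0" "\<And>q. q \<in> carr X \<Longrightarrow> q \<in> carr Y \<and> nrm Y q \<le> C * nrm X q"
    using inclusion_bounded by blast
  have "continuous_map MX.mtopology MY.mtopology (\<lambda>p. p)"
    unfolding MY.continuous_map_to_metric
  proof (intro ballI allI impI)
    fix p and \<epsilon> :: real
    assume "p \<in> topspace MX.mtopology" and \<epsilon>: "\<epsilon> > 0"
    then have p: "p \<in> carr X"
      by simp
    show "\<exists>U. openin MX.mtopology U \<and> p \<in> U \<and> (\<forall>q\<in>U. q \<in> MY.mball p \<epsilon>)"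
    proof (intro exI[of _ "MX.mball p (\<epsilon> / C)"] conjI ballI)
      fix q assume q: "q \<in> MX.mball p (\<epsilon> / C)"
      then have "dst Y p q \<le> C * dst X p q"
        using C(2)[OF h_diff[where w = w, OF w_pos t_ge_1 p, of q]] by (simp add: dst_def)
      also have "\<dots> < \<epsilon>"
        using q C(1) by (simp add: pos_less_divide_eq mult.commute)
      finally show "q \<in> MY.mball p \<epsilon>"
        using q C(2) by simp
    qed (use p \<epsilon> C(1) in auto)
  qed
  then show ?thesis
    using C(2) by (auto simp: embedding_def continuous_linear_def norm_topology_def)
qed

text \<open>On a source ball, componentwise convergence implies convergence in the target norm:
  finitely many coordinates are controlled by a product neighbourhood, and the tail is uniformly
  small because differences have source norm at most \<open>2 * R\<close>.\<close>

lemma continuous_map_h_ball: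
  "continuous_map (top_of_set (h_ball w k' t R)) (norm_topology Y) (\<lambda>p. p)"
proof -
  interpret MX: Metric_space "carr X" "dst X"
    using w_pos t_ge_1 by (rule h_Metric_space)
  interpret MY: Metric_space "carr Y" "dst Y"
    using w_pos s_ge_1 by (rule h_Metric_space)
  show ?thesis
    unfolding norm_topology_def MY.continuous_map_to_metric
  proof (intro ballI allI impI)
    fix p and \<epsilon> :: real
    assume "p \<in> topspace (top_of_set (h_ball w k' t R))" and \<epsilon>: "\<epsilon> > 0"
    then have p: "p \<in> h_ball w k' t R" "p \<in> carr X"
      by (auto simp: h_ball_def)
    \<comment> \<open>Chosen so that the tail contributes at most half of
      \<open>\<epsilon> powr s\<close>; the added 1 keeps the denominator positive when
      \<open>(2 * R) powr s\<close> vanishes.\<close>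
    define \<eta> where "\<eta> = \<epsilon> powr s / (2 * ((2 * R) powr s + 1))"
    have pos: "(2 * R) powr s + 1 > 0"
      by (smt (verit) powr_ge_zero)
    then have \<eta>: "\<eta> > 0"
      using \<epsilon> by (simp add: \<eta>_def)
    define F where "F = {m. \<eta> \<le> e m}"
    have F: "finite F"
      unfolding F_def using \<eta> by (rule finite_ge)
    define S where "S q = sum (h_term w k s (\<lambda>m. q m - p m)) F" for q
    \<comment> \<open>The other half of \<open>\<epsilon> powr s\<close> is reserved for the
      coordinates in \<open>F\<close>.\<close>
    define U where "U = h_ball w k' t R \<inter> S -` {..<\<epsilon> powr s / 2}"
    have "continuous_on (h_ball w k' t R) S"
      unfolding S_def by (intro continuous_on_sum continuous_on_h_term w_pos s_ge_1)
    then have "openin (top_of_set (h_ball w k' t R)) U"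
      unfolding U_def by (rule continuous_openin_preimage_gen) simp
    moreover have "p \<in> U"
      using p \<epsilon> by (simp add: U_def S_def h_term_def)
    moreover have "q \<in> MY.mball p \<epsilon>" if "q \<in> U" for q
    proof -
      have q: "q \<in> h_ball w k' t R" "q \<in> carr X" "S q < \<epsilon> powr s / 2"
        using that by (auto simp: U_def h_ball_def)
      have "nrm X (\<lambda>m. q m - p m) powr s \<le> (2 * R) powr s"
        using h_ball_diff_nrm_le[where w = w, OF w_pos t_ge_1 q(1) p(1)] s_ge_1
          h_nrm_nonneg[where w = w, OF w_pos t_ge_1] by (intro powr_mono2) auto
      then have "\<eta> * nrm X (\<lambda>m. q m - p m) powr s \<le> \<eta> * ((2 * R) powr s + 1)"
        using \<eta> by (intro mult_left_mono) auto
      also have "\<dots> = \<epsilon> powr s / 2"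
        using pos unfolding \<eta>_def
        by (metis divide_divide_eq_left nonzero_eq_divide_eq order_less_irrefl)
      finally have "nrm Y (\<lambda>m. q m - p m) powr s < \<epsilon> powr s"
        using inclusion_tail_estimate(2)[OF h_diff[where w = w, OF w_pos t_ge_1 q(2) p(2)] F, of \<eta>] \<eta> q(3)
        by (force simp: F_def S_def)
      then have "dst Y q p < \<epsilon>"
        using \<epsilon> s_ge_1 powr_mono2[of s \<epsilon> "dst Y q p"] by (force simp: dst_def)
      then show ?thesis
        using p q embedding_inclusion MY.commute by (auto simp: embedding_def)
    qed
    ultimately show "\<exists>U. openin (top_of_set (h_ball w k' t R)) U \<and> p \<in> U
                         \<and> (\<forall>q\<in>U. q \<in> MY.mball p \<epsilon>)"
      by blast
  qed
qed

text \<open>A bounded set lies in a source ball, which is compact componentwise; the continuous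
  inclusion carries this compactness to the target norm.\<close>

lemma compact_embedding_inclusion: "compact_embedding X Y"
proof -
  interpret MY: Metric_space "carr Y" "dst Y"
    using w_pos s_ge_1 by (rule h_Metric_space)
  have "compactin (norm_topology Y) (norm_topology Y closure_of B)" if B: "bounded_in X B" for B
  proof -
    obtain R where R: "R \<ge> 0" "B \<subseteq> h_ball w k' t R"
      using bounded_in_imp_subset_h_ball[where w = w, OF w_pos t_ge_1 B] by blast
    have "compactin (top_of_set (h_ball w k' t R)) (h_ball w k' t R)"
      using compact_h_ball[where w = w, OF w_pos t_ge_1 R(1)] by (simp add: compactin_subtopology)
    then have K: "compactin (norm_topology Y) (h_ball w k' t R)"
      using image_compactin[OF _ continuous_map_h_ball] by fastforce
    \<comment> \<open>The target is Hausdorff, so the compact ball is closed and contains the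
      closure of \<open>B\<close>.\<close>
    then have "closedin (norm_topology Y) (h_ball w k' t R)"
      using MY.Hausdorff_space_mtopology by (simp add: norm_topology_def compactin_imp_closedin)
    then show ?thesis
      using K R(2) closed_compactin closure_of_minimal closedin_closure_of by metis
  qed
  then show ?thesis
    using embedding_inclusion
    by (simp add: compact_embedding_def compact_operator_def embedding_def)
qed

end

section \<open>The vanishing factor in the two cases\<close>

text \<open>For equal exponents, \<open>e m\<close> is the exact quotient of the two weight factors;
  it vanishes at infinity because \<open>k - k'\<close> is negative.\<close>

lemma compact_embedding_same_exponent:
  assumes w_pos: "\<And>m. w m > 0" and "1 \<le> s" "k < k'"
  shows "compact_embedding (h_space w k' s) (h_space w k s)"
proof (rule compact_embedding_inclusion)
  show "((\<lambda>m. (1 + \<bar>real_of_int m\<bar> powr s) powr (k - k')) \<longlongrightarrow> 0) cofinite"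
    using assms by (intro powr_one_add_abs_tendsto_0) auto
  fix q m
  have "1 + \<bar>real_of_int m\<bar> powr s > 0"
    by (smt (verit) powr_ge_zero)
  then show "h_term w k s q m
      \<le> (1 + \<bar>real_of_int m\<bar> powr s) powr (k - k') * h_term w k' s q m powr (s / s)"
    using assms h_term_nonneg[where w = w, OF assms(1,2), of k' q m]
    by (simp add: h_term_def powr_diff)
qed (use assms in auto)

lemma compact_embedding_bounded_below:
  assumes w_pos: "\<And>m. w m > 0" and c: "0 < c" "\<And>m. c \<le> w m"
    and "0 \<le> k" "k < k'" "1 \<le> t" "t \<le> s"
  shows "compact_embedding (h_space w k' t) (h_space w k s)"
proof (rule compact_embedding_inclusion)
  have "((\<lambda>m. c powr (1 - s / t) * (1 + \<bar>real_of_int m\<bar> powr t) powr ((k - k') * s / t))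
          \<longlongrightarrow> c powr (1 - s / t) * 0) cofinite"
    using assms
    by (intro tendsto_mult tendsto_const powr_one_add_abs_tendsto_0)
      (auto intro!: divide_neg_pos mult_neg_pos)
  then show "((\<lambda>m. c powr (1 - s / t) * (1 + \<bar>real_of_int m\<bar> powr t) powr ((k - k') * s / t))
          \<longlongrightarrow> 0) cofinite"
    by simp
  fix q m
  define b where "b = 1 + \<bar>real_of_int m\<bar> powr t"
  have b: "b > 0"
    unfolding b_def by (smt (verit) powr_ge_zero)
  have r: "s / t \<ge> 1"
    using assms by simp
  have "h_term w k s q m \<le> w m * b powr (k * s / t) * cmod (q m) powr s"
    unfolding h_term_def b_def using assms less_imp_le[OF w_pos[of m]]
    by (intro mult_right_mono mult_left_mono one_add_powr_le) auto
  \<comment> \<open>The factor \<open>w m powr (s / t)\<close> belongs to the power of the source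
    term. The remaining exponent \<open>1 - s / t\<close> is nonpositive, so the lower bound
    \<open>c\<close> on \<open>w m\<close> gives an upper bound on the other factor.\<close>
  also have "w m = w m powr (1 - s / t) * w m powr (s / t)"
    using w_pos[of m] by (simp add: powr_add[symmetric])
  also have "\<dots> * b powr (k * s / t) * cmod (q m) powr s
      \<le> c powr (1 - s / t) * w m powr (s / t) * b powr (k * s / t) * cmod (q m) powr s"
    using r c w_pos[of m] by (intro mult_right_mono powr_mono2') auto
  also have "b powr (k * s / t) = b powr ((k - k') * s / t) * b powr (k' * s / t)"
    by (simp add: powr_add[symmetric] add_divide_distrib[symmetric] algebra_simps)
  also have "c powr (1 - s / t) * w m powr (s / t) * \<dots> * cmod (q m) powr s
      = c powr (1 - s / t) * b powr ((k - k') * s / t) * h_term w k' t q m powr (s / t)"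
    using assms less_imp_le[OF w_pos[of m]] b
    by (simp add: h_term_def b_def[symmetric] powr_mult powr_powr)
  finally show "h_term w k s q m
      \<le> c powr (1 - s / t) * (1 + \<bar>real_of_int m\<bar> powr t) powr ((k - k') * s / t)
          * h_term w k' t q m powr (s / t)"
    by (simp add: b_def)
qed (use assms in auto)

theorem theorem1:
  fixes w :: "int \<Rightarrow> real"
  assumes w_pos: "\<And>m. w m > 0"
  shows "(\<forall>s k k' :: real. 1 \<le> s \<longrightarrow> k < k' \<longrightarrow>
            compact_embedding (h_space w k' s) (h_space w k s)) \<and>
         (\<forall>k k' :: real. 0 \<le> k \<longrightarrow> k < k' \<longrightarrow> 0 < (INF m. w m) \<longrightarrow>
            (\<forall>s t :: real. s \<ge> t \<longrightarrow> t \<ge> 1 \<longrightarrow>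
               compact_embedding (h_space w k' t) (h_space w k s) \<and>
               compact_embedding (h_space w k' t) (l_space w s)))"
proof -
  have "(INF m. w m) \<le> w m" for m
    using w_pos by (intro cINF_lower bdd_belowI2[where m = 0]) (auto intro: less_imp_le)
  \<comment> \<open>The infimum serves as \<open>c\<close>. The target \<open>l_space\<close> is the
    instance with target index 0, admissible since \<open>0 \<le> k < k'\<close> makes
    \<open>k'\<close> positive.\<close>
  then show ?thesis
    using w_pos compact_embedding_same_exponent[of w]
      compact_embedding_bounded_below[of w "INF m. w m"]
    by (auto simp: l_space_def)
qed

end
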